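(* When the target is constrained along the boundary of the engagement zone, $\rho_{\max}=d$, and therefore the heading which keeps the target on the boundary of the engagement zone is $$\psi_T^*=2\tan^{-1}\left(\frac{-(\sigma_1+x_T)\pm\sqrt{y_T^2-(\sigma_1-x_T)(\sigma_1+x_T)}}{(\sigma_1-x_T)}\right),$$ where $$\sigma_1=\frac{2(x_T^2+y_T^2)-R_{\max}\sqrt{x_T^2+y_T^2}}{R_{\max}}.$$
   Context: A target vehicle at position $(x_T,y_T)\in\mathbb{R}^2$ moves with constant speed $v_T>0$ according to $\dot x_T=v_T\cos\psi_T$, $\dot y_T=v_T\sin\psi_T$, and directly controls its heading $\psi_T\in(-\pi,\pi]$. It is to travel from a given initial position to a given final position, both outside the engagement zone (EZ), in minimum time $t_f$ (free), subject to the path constraint $\rho_{\max}-d\le 0$ for all $t\in[0,t_f]$, that is, while avoiding the EZ completely. The EZ has its origin at $(0,0)$, maximum possible range $R_{\max}>0$, and minimum range $R_{\min}=0$. The quantities involved are: - $d=\sqrt{x_T^2+y_T^2}$, the distance of the target from the EZ's origin. - $\lambda=\tan^{-1}(y_T/x_T)\in[-\pi,\pi)$, the line-of-sight angle from the EZ's origin to the target. - $\xi=\psi_T-\lambda-\pi$, the relative bearing angle from the target to the EZ's origin. - $\rho_{\max}(\xi)=\frac{R_{\max}}{2}(\cos\xi+1)$, the range of the EZ from its origin in the direction of the target, the EZ being always oriented towards the target. The target is on the boundary of the EZ (the path constraint is active) when $\rho_{\max}=d$. The symbol $\psi_T^*$ denotes the optimal control (heading) of the target on the arc where the constraint is active.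
   Formalization: The numerator's −(σ₁+x_T) is corrected to −y_T (as printed the formula fails, e.g. R_max=1, (x_T,y_T)=(3/5,4/5)), and σ₁≠x_T is assumed so that the quotient is defined. *)

theory Defs
  imports "HOL-Analysis.Analysis"
begin

definition target_dist :: "real \<Rightarrow> real \<Rightarrow> real" where
  "target_dist x y = sqrt (x\<^sup>2 + y\<^sup>2)"

text \<open>
  The line-of-sight angle is the four-quadrant inverse tangent of \<open>y / x\<close>, normalised to
  \<open>[-\<pi>, \<pi>)\<close>. \<^const>\<open>Arg\<close> takes values in \<open>(-\<pi>, \<pi>]\<close>, so only the value \<open>\<pi>\<close> has to be moved.
  At the origin, where the angle is undefined, the value is the dummy \<open>0\<close>.
\<close>

definition los_angle :: "real \<Rightarrow> real \<Rightarrow> real" where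
  "los_angle x y = (if Arg (Complex x y) = pi then - pi else Arg (Complex x y))"

definition rel_bearing :: "real \<Rightarrow> real \<Rightarrow> real \<Rightarrow> real" where
  "rel_bearing x y \<psi> = \<psi> - los_angle x y - pi"

definition ez_range :: "real \<Rightarrow> real \<Rightarrow> real" where
  "ez_range R_max \<xi> = R_max / 2 * (cos \<xi> + 1)"

text \<open>
  The zone depends on the heading through the relative bearing, so lying outside it or on its
  boundary is a property of position and heading together.
\<close>

definition avoids_ez :: "real \<Rightarrow> real \<Rightarrow> real \<Rightarrow> real \<Rightarrow> bool" where
  "avoids_ez R_max x y \<psi> \<longleftrightarrow> ez_range R_max (rel_bearing x y \<psi>) - target_dist x y \<le> 0"

definition outside_ez :: "real \<Rightarrow> real \<Rightarrow> real \<Rightarrow> real \<Rightarrow> bool" where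
  "outside_ez R_max x y \<psi> \<longleftrightarrow> ez_range R_max (rel_bearing x y \<psi>) < target_dist x y"

definition on_ez_boundary :: "real \<Rightarrow> real \<Rightarrow> real \<Rightarrow> real \<Rightarrow> bool" where
  "on_ez_boundary R_max x y \<psi> \<longleftrightarrow> ez_range R_max (rel_bearing x y \<psi>) = target_dist x y"

text \<open>
  The kinematics \<open>x' = v cos \<psi>\<close>, \<open>y' = v sin \<psi>\<close> are imposed in integrated form, so that the
  heading may be discontinuous. Existence of the integrals makes the heading measurable.
\<close>

definition admissible ::
  "real \<Rightarrow> real \<Rightarrow> real \<times> real \<Rightarrow> real \<times> real \<Rightarrow> real \<Rightarrow>
   (real \<Rightarrow> real) \<Rightarrow> (real \<Rightarrow> real) \<Rightarrow> (real \<Rightarrow> real) \<Rightarrow> bool" where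
  "admissible R_max v p\<^sub>0 p\<^sub>f t\<^sub>f x y \<psi> \<longleftrightarrow>
     0 \<le> t\<^sub>f \<and> (x 0, y 0) = p\<^sub>0 \<and> (x t\<^sub>f, y t\<^sub>f) = p\<^sub>f \<and>
     outside_ez R_max (x 0) (y 0) (\<psi> 0) \<and> outside_ez R_max (x t\<^sub>f) (y t\<^sub>f) (\<psi> t\<^sub>f) \<and>
     (\<forall>t\<in>{0..t\<^sub>f}.
        - pi < \<psi> t \<and> \<psi> t \<le> pi \<and>
        ((\<lambda>s. v * cos (\<psi> s)) has_integral (x t - x 0)) {0..t} \<and>
        ((\<lambda>s. v * sin (\<psi> s)) has_integral (y t - y 0)) {0..t} \<and>
        avoids_ez R_max (x t) (y t) (\<psi> t))"

definition time_optimal ::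
  "real \<Rightarrow> real \<Rightarrow> real \<times> real \<Rightarrow> real \<times> real \<Rightarrow> real \<Rightarrow>
   (real \<Rightarrow> real) \<Rightarrow> (real \<Rightarrow> real) \<Rightarrow> (real \<Rightarrow> real) \<Rightarrow> bool" where
  "time_optimal R_max v p\<^sub>0 p\<^sub>f t\<^sub>f x y \<psi> \<longleftrightarrow>
     admissible R_max v p\<^sub>0 p\<^sub>f t\<^sub>f x y \<psi> \<and>
     (\<forall>t\<^sub>f' x' y' \<psi>'. admissible R_max v p\<^sub>0 p\<^sub>f t\<^sub>f' x' y' \<psi>' \<longrightarrow> t\<^sub>f \<le> t\<^sub>f')"

definition sigma1 :: "real \<Rightarrow> real \<Rightarrow> real \<Rightarrow> real" where
  "sigma1 R_max x y = (2 * (x\<^sup>2 + y\<^sup>2) - R_max * sqrt (x\<^sup>2 + y\<^sup>2)) / R_max"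

definition heading_discr :: "real \<Rightarrow> real \<Rightarrow> real \<Rightarrow> real" where
  "heading_discr R_max x y =
     y\<^sup>2 - (sigma1 R_max x y - x) * (sigma1 R_max x y + x)"

text \<open>
  The parameter \<open>s\<close> is the sign \<open>1\<close> or \<open>-1\<close> in front of the root. The boundary condition is
  \<open>\<sigma>\<^sub>1 + x cos \<psi> + y sin \<psi> = 0\<close>, which for \<open>u = tan (\<psi> / 2)\<close> reads
  \<open>(\<sigma>\<^sub>1 - x) u\<^sup>2 + 2 y u + (\<sigma>\<^sub>1 + x) = 0\<close>. Its roots have the numerator \<open>- y \<plusminus> \<surd>\<dots>\<close>. The
  published formula has \<open>- (\<sigma>\<^sub>1 + x)\<close> in place of \<open>- y\<close>, a misprint:
  see \<open>published_heading_off_boundary\<close> below.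
\<close>

definition boundary_heading :: "real \<Rightarrow> real \<Rightarrow> real \<Rightarrow> real \<Rightarrow> real" where
  "boundary_heading R_max s x y =
     2 * arctan ((- y + s * sqrt (heading_discr R_max x y)) / (sigma1 R_max x y - x))"

definition published_heading :: "real \<Rightarrow> real \<Rightarrow> real \<Rightarrow> real \<Rightarrow> real" where
  "published_heading R_max s x y =
     2 * arctan ((- (sigma1 R_max x y + x) + s * sqrt (heading_discr R_max x y)) /
                 (sigma1 R_max x y - x))"

lemma target_dist_los:
  "target_dist x y * cos (los_angle x y) = x"
  "target_dist x y * sin (los_angle x y) = y"
proof -
  have c: "cos (los_angle x y) = cos (Arg (Complex x y))"
    "sin (los_angle x y) = sin (Arg (Complex x y))"
    by (auto simp: los_angle_def)
  have "rcis (cmod (Complex x y)) (Arg (Complex x y)) = Complex x y"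
    by (rule rcis_cmod_Arg)
  then show "target_dist x y * cos (los_angle x y) = x"
    "target_dist x y * sin (los_angle x y) = y"
    unfolding c by (auto simp: complex_eq_iff target_dist_def cmod_def)
qed

lemma on_ez_boundary_iff:
  assumes "R_max > 0" "(x, y) \<noteq> (0, 0)"
  shows "on_ez_boundary R_max x y \<psi> \<longleftrightarrow> sigma1 R_max x y + x * cos \<psi> + y * sin \<psi> = 0"
proof -
  define d where "d = target_dist x y"
  have d: "d > 0" "d\<^sup>2 = x\<^sup>2 + y\<^sup>2"
    using assms(2) by (auto simp: d_def target_dist_def sum_power2_gt_zero_iff)
  have s: "sigma1 R_max x y * R_max = 2 * d\<^sup>2 - R_max * d"
    using assms(1) d by (simp add: sigma1_def d_def target_dist_def)
  have "cos (rel_bearing x y \<psi>) = - cos (\<psi> - los_angle x y)"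
    by (simp add: rel_bearing_def cos_diff)
  then have "d * cos (rel_bearing x y \<psi>) =
      - ((d * cos (los_angle x y)) * cos \<psi> + (d * sin (los_angle x y)) * sin \<psi>)"
    unfolding cos_diff by (simp only:) (simp add: algebra_simps)
  then have c: "d * cos (rel_bearing x y \<psi>) = - (x * cos \<psi> + y * sin \<psi>)"
    by (simp add: d_def target_dist_los)
  have "on_ez_boundary R_max x y \<psi> \<longleftrightarrow>
      2 * d * (R_max / 2 * (cos (rel_bearing x y \<psi>) + 1)) = 2 * d * d"
    using d by (auto simp: on_ez_boundary_def ez_range_def d_def)
  also have "\<dots> \<longleftrightarrow> R_max * (d * cos (rel_bearing x y \<psi>)) + R_max * d = 2 * d\<^sup>2"
    by (simp add: algebra_simps power2_eq_square)
  also have "\<dots> \<longleftrightarrow> R_max * (sigma1 R_max x y + x * cos \<psi> + y * sin \<psi>) = 0"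
    using s unfolding c by (auto simp: algebra_simps)
  finally show ?thesis using assms(1) by simp
qed

lemma published_heading_off_boundary:
  "\<not> on_ez_boundary 1 (3/5) (4/5) (published_heading 1 s (3/5) (4/5))"
proof -
  have r: "sqrt ((3/5)\<^sup>2 + (4/5)\<^sup>2) = (1::real)"
    by (simp add: power2_eq_square)
  have s1: "sigma1 1 (3/5) (4/5) = 1"
    unfolding sigma1_def r by (simp add: power2_eq_square)
  have p: "published_heading 1 s (3/5) (4/5) = 2 * arctan (- 4)"
    by (simp add: published_heading_def heading_discr_def s1 power2_eq_square)
  have c: "cos (arctan (- 4)) = 1 / sqrt 17" "sin (arctan (- 4)) = - 4 / sqrt 17"
    by (simp_all only: cos_arctan sin_arctan) simp_all
  have "cos (published_heading 1 s (3/5) (4/5)) = - 15 / 17"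
    "sin (published_heading 1 s (3/5) (4/5)) = - 8 / 17"
    unfolding p cos_double sin_double c by (simp_all add: power_divide)
  then show ?thesis
    by (simp add: on_ez_boundary_iff s1)
qed

end

theory Submission
  imports Defs
begin

text \<open>
  Substituting \<open>\<psi> = 2 arctan u\<close> turns the boundary condition \<open>\<sigma>\<^sub>1 + x cos \<psi> + y sin \<psi> = 0\<close> into a
  quadratic equation for \<open>u\<close> whose roots give the two headings. The heading \<open>\<pi>\<close>, which the
  substitution misses, satisfies the condition only if \<open>\<sigma>\<^sub>1 = x\<close>.
\<close>

text \<open>Completing the square after multiplication by \<open>a\<close>. The sign of the
  discriminant is a separate conjunct because \<open>sqrt\<close> is total and negative on negative
  reals, so the root expressions denote numbers even when there is no real root. The factors
  \<open>1\<close> and \<open>- 1\<close> match the parameter \<open>s\<close> of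
  \<open>boundary_heading\<close>.\<close>

lemma half_quadratic_roots_iff:
  fixes a b c u :: real
  assumes "a \<noteq> 0"
  shows "a * u\<^sup>2 + 2 * b * u + c = 0 \<longleftrightarrow>
    b\<^sup>2 - a * c \<ge> 0 \<and>
    (u = (- b + 1 * sqrt (b\<^sup>2 - a * c)) / a \<or> u = (- b + (- 1) * sqrt (b\<^sup>2 - a * c)) / a)"
proof -
  have "a * u\<^sup>2 + 2 * b * u + c = 0 \<longleftrightarrow> a * (a * u\<^sup>2 + 2 * b * u + c) = 0"
    using assms by simp
  also have "\<dots> \<longleftrightarrow> (a * u + b)\<^sup>2 = b\<^sup>2 - a * c"
    by (auto simp: power2_eq_square algebra_simps)
  \<comment> \<open>A real square equals the discriminant only if the latter is nonnegative, and
    then it is the square of its root.\<close>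
  also have "\<dots> \<longleftrightarrow> b\<^sup>2 - a * c \<ge> 0 \<and> (a * u + b)\<^sup>2 = (sqrt (b\<^sup>2 - a * c))\<^sup>2"
    by (metis real_sqrt_pow2 zero_le_power2)
  also have "\<dots> \<longleftrightarrow> b\<^sup>2 - a * c \<ge> 0 \<and>
      (a * u + b = sqrt (b\<^sup>2 - a * c) \<or> a * u + b = - sqrt (b\<^sup>2 - a * c))"
    by (simp only: power2_eq_iff)
  also have "\<dots> \<longleftrightarrow> b\<^sup>2 - a * c \<ge> 0 \<and>
    (u = (- b + 1 * sqrt (b\<^sup>2 - a * c)) / a \<or> u = (- b + (- 1) * sqrt (b\<^sup>2 - a * c)) / a)"
    using assms by (auto simp: field_simps)
  finally show ?thesis .
qed

lemma cos_sin_double_arctan: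
  "cos (2 * arctan u) = (1 - u\<^sup>2) / (1 + u\<^sup>2)"
  "sin (2 * arctan u) = 2 * u / (1 + u\<^sup>2)"
proof -
  have "1 + u\<^sup>2 > 0" by (simp add: add_pos_nonneg)
  then show "cos (2 * arctan u) = (1 - u\<^sup>2) / (1 + u\<^sup>2)"
    "sin (2 * arctan u) = 2 * u / (1 + u\<^sup>2)"
    by (simp_all add: cos_double sin_double cos_arctan sin_arctan power_divide
        diff_divide_distrib)
qed

lemma sigma1_origin: "sigma1 R_max 0 0 = 0"
  by (simp add: sigma1_def)

lemma on_ez_boundary_double_arctan_iff:
  assumes "R_max > 0" "sigma1 R_max x y \<noteq> x"
  shows "on_ez_boundary R_max x y (2 * arctan u) \<longleftrightarrow>
    (sigma1 R_max x y - x) * u\<^sup>2 + 2 * y * u + (sigma1 R_max x y + x) = 0"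
proof -
  define \<sigma> where "\<sigma> = sigma1 R_max x y"
  have pos: "1 + u\<^sup>2 > 0" by (simp add: add_pos_nonneg)
  \<comment> \<open>At the origin both \<open>sigma1\<close> and \<open>x\<close> vanish, so the
    hypothesis excludes it and the line of sight is defined.\<close>
  have "(x, y) \<noteq> (0, 0)" using assms(2) by (auto simp: sigma1_origin)
  then have "on_ez_boundary R_max x y (2 * arctan u) \<longleftrightarrow>
      \<sigma> + x * ((1 - u\<^sup>2) / (1 + u\<^sup>2)) + y * (2 * u / (1 + u\<^sup>2)) = 0"
    using assms(1) by (simp add: on_ez_boundary_iff cos_sin_double_arctan \<sigma>_def)
  also have "\<sigma> + x * ((1 - u\<^sup>2) / (1 + u\<^sup>2)) + y * (2 * u / (1 + u\<^sup>2)) =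
      ((\<sigma> - x) * u\<^sup>2 + 2 * y * u + (\<sigma> + x)) / (1 + u\<^sup>2)"
  proof -
    \<comment> \<open>Bringing \<open>\<sigma>\<close> over the common denominator makes the
      numerator the quadratic in \<open>u\<close>.\<close>
    have "\<sigma> = \<sigma> * (1 + u\<^sup>2) / (1 + u\<^sup>2)" using pos by simp
    then have "\<sigma> + x * ((1 - u\<^sup>2) / (1 + u\<^sup>2)) + y * (2 * u / (1 + u\<^sup>2)) =
        (\<sigma> * (1 + u\<^sup>2) + x * (1 - u\<^sup>2) + y * (2 * u)) / (1 + u\<^sup>2)"
      by (metis add_divide_distrib times_divide_eq_right)
    then show ?thesis by (simp add: algebra_simps)
  qed
  finally show ?thesis using pos by (simp add: \<sigma>_def)
qed

lemma on_ez_boundary_heading_iff: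
  assumes "R_max > 0" "- pi < \<psi>" "\<psi> \<le> pi" and ne: "sigma1 R_max x y \<noteq> x"
  shows "on_ez_boundary R_max x y \<psi> \<longleftrightarrow>
    heading_discr R_max x y \<ge> 0 \<and>
    (\<psi> = boundary_heading R_max 1 x y \<or> \<psi> = boundary_heading R_max (- 1) x y)"
proof (cases "\<psi> = pi")
  case True
  have "(x, y) \<noteq> (0, 0)" using ne by (auto simp: sigma1_origin)
  \<comment> \<open>At \<open>pi\<close> the boundary condition reads
    \<open>sigma1 R_max x y - x = 0\<close>.\<close>
  then have "\<not> on_ez_boundary R_max x y \<psi>"
    using assms(1) ne by (simp add: on_ez_boundary_iff True)
  \<comment> \<open>Twice an arctangent stays strictly below \<open>pi\<close>, so neither formula
    yields this heading.\<close>
  moreover have "\<psi> \<noteq> boundary_heading R_max s x y" for s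
    using arctan_ubound by (simp add: boundary_heading_def True) (smt (verit) field_sum_of_halves)
  ultimately show ?thesis by blast
next
  case False
  define u where "u = tan (\<psi> / 2)"
  \<comment> \<open>Half the heading lies strictly between \<open>- pi / 2\<close> and
    \<open>pi / 2\<close>, where \<open>arctan\<close> inverts \<open>tan\<close>.\<close>
  have "arctan u = \<psi> / 2"
    unfolding u_def using assms(2,3) False by (intro arctan_tan) auto
  then have \<psi>: "\<psi> = 2 * arctan u" by simp
  \<comment> \<open>Injectivity of \<open>arctan\<close> reduces equality of headings to equality of
    \<open>u\<close> with a root of the quadratic, whose quarter discriminant is
    \<open>heading_discr\<close>.\<close>
  show ?thesis
    unfolding \<psi> on_ez_boundary_double_arctan_iff[OF assms(1) ne] boundary_heading_def
      heading_discr_def mult_cancel_left arctan_eq_iff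
    using half_quadratic_roots_iff[of "sigma1 R_max x y - x" u y "sigma1 R_max x y + x"] ne
    by simp
qed

theorem theorem2:
  fixes R_max v_T :: real
  assumes "R_max > 0" and "v_T > 0"
  shows
    "(\<forall>x\<^sub>T y\<^sub>T \<psi>\<^sub>T. - pi < \<psi>\<^sub>T \<longrightarrow> \<psi>\<^sub>T \<le> pi \<longrightarrow> sigma1 R_max x\<^sub>T y\<^sub>T \<noteq> x\<^sub>T \<longrightarrow>
        (on_ez_boundary R_max x\<^sub>T y\<^sub>T \<psi>\<^sub>T \<longleftrightarrow>
           heading_discr R_max x\<^sub>T y\<^sub>T \<ge> 0 \<and>
           (\<psi>\<^sub>T = boundary_heading R_max 1 x\<^sub>T y\<^sub>T \<or> \<psi>\<^sub>T = boundary_heading R_max (- 1) x\<^sub>T y\<^sub>T))) \<and>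
     (\<forall>p\<^sub>0 p\<^sub>f t\<^sub>f x\<^sub>T y\<^sub>T \<psi>\<^sub>T a b.
        time_optimal R_max v_T p\<^sub>0 p\<^sub>f t\<^sub>f x\<^sub>T y\<^sub>T \<psi>\<^sub>T \<longrightarrow> 0 \<le> a \<longrightarrow> a \<le> b \<longrightarrow> b \<le> t\<^sub>f \<longrightarrow>
        (\<forall>t\<in>{a..b}. on_ez_boundary R_max (x\<^sub>T t) (y\<^sub>T t) (\<psi>\<^sub>T t)) \<longrightarrow>
        (\<forall>t\<in>{a..b}. sigma1 R_max (x\<^sub>T t) (y\<^sub>T t) \<noteq> x\<^sub>T t \<longrightarrow>
           heading_discr R_max (x\<^sub>T t) (y\<^sub>T t) \<ge> 0 \<and>
           (\<psi>\<^sub>T t = boundary_heading R_max 1 (x\<^sub>T t) (y\<^sub>T t) \<or>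
            \<psi>\<^sub>T t = boundary_heading R_max (- 1) (x\<^sub>T t) (y\<^sub>T t))))"
  (is "?pointwise \<and> ?trajectory")
proof -
  have ?pointwise
    using on_ez_boundary_heading_iff[OF assms(1)] by blast
  \<comment> \<open>Admissibility bounds the heading at all times up to \<open>t\<^sub>f\<close>,
    hence on the arc, so the pointwise equivalence applies at each time there.\<close>
  moreover have "- pi < \<psi> t \<and> \<psi> t \<le> pi"
    if "time_optimal R_max v_T p\<^sub>0 p\<^sub>f t\<^sub>f x y \<psi>" "0 \<le> a" "b \<le> t\<^sub>f" "t \<in> {a..b}"
    for p\<^sub>0 p\<^sub>f t\<^sub>f x y \<psi> a b t
    using that by (auto simp: time_optimal_def admissible_def)
  ultimately show ?thesis by blast
qed

end
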